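(* For every integer $n\ge 0$, $c\phi_7(5n+3)\equiv 0\pmod 5$.
   Context: A $k$-colored generalized Frobenius symbol is a two-row array with $d\ge 0$ columns whose entries are colored nonnegative integers $\ell_c$ ($\ell\ge 0$, color $c\in\{1,\dots,k\}$), each row strictly decreasing with respect to the total order $0_1\prec 0_2\prec\cdots\prec 0_k\prec 1_1\prec\cdots\prec 1_k\prec 2_1\prec\cdots$. It is a $k$-colored generalized Frobenius partition of $n=d+\sum(\text{integer values of all entries})$, and $c\phi_k(n)$ is the number of such partitions of $n$. *)

theory Defs
  imports "HOL-Number_Theory.Cong"
begin

text \<open>The pair \<open>(l, c)\<close> encodes the integer \<open>l\<close> in color \<open>c\<close>, written \<open>l\<^sub>c\<close>.\<close>

type_synonym colored_nat = "nat \<times> nat"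

definition colored_less :: "colored_nat \<Rightarrow> colored_nat \<Rightarrow> bool" (infix "\<prec>" 50) where
  "x \<prec> y \<longleftrightarrow> fst x < fst y \<or> fst x = fst y \<and> snd x < snd y"

definition frobenius_row :: "nat \<Rightarrow> colored_nat list \<Rightarrow> bool" where
  "frobenius_row k xs \<longleftrightarrow> (\<forall>x\<in>set xs. snd x \<in> {1..k}) \<and> sorted_wrt (\<lambda>x y. y \<prec> x) xs"

definition frobenius_symbol :: "nat \<Rightarrow> colored_nat list \<times> colored_nat list \<Rightarrow> bool" where
  "frobenius_symbol k S \<longleftrightarrow>
     frobenius_row k (fst S) \<and> frobenius_row k (snd S) \<and> length (fst S) = length (snd S)"

definition frobenius_weight :: "colored_nat list \<times> colored_nat list \<Rightarrow> nat" where
  "frobenius_weight S = length (fst S) + sum_list (map fst (fst S)) + sum_list (map fst (snd S))"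

definition frobenius_partitions :: "nat \<Rightarrow> nat \<Rightarrow> (colored_nat list \<times> colored_nat list) set" where
  "frobenius_partitions k n = {S. frobenius_symbol k S \<and> frobenius_weight S = n}"

definition cphi :: "nat \<Rightarrow> nat \<Rightarrow> nat" where
  "cphi k n = card (frobenius_partitions k n)"

text \<open>The cardinality above is that of a finite set, hence a genuine count.\<close>

lemma finite_frobenius_partitions: "finite (frobenius_partitions k n)"
proof (rule finite_subset)
  let ?R = "{xs. set xs \<subseteq> {0..n} \<times> {1..k} \<and> length xs \<le> n}"
  show "finite (?R \<times> ?R)"
    by (intro finite_cartesian_product finite_lists_length_le) auto
  show "frobenius_partitions k n \<subseteq> ?R \<times> ?R"
  proof
    fix S assume S: "S \<in> frobenius_partitions k n"
    have le: "fst x \<le> sum_list (map fst xs)" if "x \<in> set xs" for x and xs :: "colored_nat list"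
      using that by (intro member_le_sum_list) auto
    have "fst x \<le> n" if "x \<in> set (fst S) \<union> set (snd S)" for x
      using that S le[of x "fst S"] le[of x "snd S"]
      by (auto simp: frobenius_partitions_def frobenius_weight_def)
    then show "S \<in> ?R \<times> ?R"
      using S by (fastforce simp: frobenius_partitions_def frobenius_symbol_def
          frobenius_row_def frobenius_weight_def mem_Times_iff)
  qed
qed

end

theory Submission
  imports Defs "HOL-Computational_Algebra.Primes" "HOL-Computational_Algebra.Polynomial"
begin

text \<open>
  With \<open>F(z,q) = \<Prod>i\<ge>0. (1 + z q^(i+1)) (1 + z\<inverse> q^i)\<close>, the number \<open>c\<phi>\<^sub>7(n)\<close> is the coefficient of
  \<open>z^0 q^n\<close> in \<open>F^7\<close>. Modulo 5, \<open>F(z,q)^7 \<equiv> F(z^5,q^5) F(z,q)^2\<close>; the Jacobi triple product gives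
  \<open>F = (\<Sum>a. z^a q^(a(a+1)/2)) / (q)\<close> with \<open>(q) = \<Prod>i\<ge>1. (1 - q^i)\<close>, and \<open>1/(q)^2 = (q)^3/(q)^5\<close>, where \<open>(q)^5\<close> is a series in
  \<open>q^5\<close> modulo 5 and Jacobi's identity gives \<open>2 (q)^3 = \<Sum>w\<in>\<int>. (-1)^w (2w+1) q^(w(w+1)/2)\<close>. A term
  \<open>(2w+1) z^(a+b) q^(a(a+1)/2 + b(b+1)/2 + w(w+1)/2)\<close> can meet \<open>z^0 q^(5n+3)\<close> only if
  \<open>5 dvd a + b\<close> and the exponent of \<open>q\<close> is 3 modulo 5, which forces \<open>(2w+1)^2 \<equiv> 2 a^2\<close>, hence
  \<open>5 dvd 2w+1\<close> because 2 is not a square modulo 5. Infinite products are replaced by finite ones,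
  polynomials in \<open>z\<close> with coefficients in \<open>\<int>[q]\<close>, compared modulo 5 and \<open>q^(L+1)\<close>.
\<close>

subsection \<open>Congruence modulo 5 of truncated polynomials\<close>

definition tcong :: "nat \<Rightarrow> int poly \<Rightarrow> int poly \<Rightarrow> bool" where
  "tcong L f g \<longleftrightarrow> (\<forall>i\<le>L. [coeff f i = coeff g i] (mod 5))"

definition zcong :: "nat \<Rightarrow> int poly poly \<Rightarrow> int poly poly \<Rightarrow> bool" where
  "zcong L p r \<longleftrightarrow> (\<forall>j. tcong L (coeff p j) (coeff r j))"

lemma tcong_refl [simp]: "tcong L f f"
  by (simp add: tcong_def)

lemma tcong_sym: "tcong L f g \<Longrightarrow> tcong L g f"
  by (simp add: tcong_def cong_sym)

lemma tcong_trans [trans]: "tcong L f g \<Longrightarrow> tcong L g h \<Longrightarrow> tcong L f h"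
  unfolding tcong_def using cong_trans by blast

lemma tcong_mult: "tcong L f g \<Longrightarrow> tcong L f' g' \<Longrightarrow> tcong L (f * f') (g * g')"
  unfolding tcong_def by (auto simp: coeff_mult intro!: cong_sum cong_mult)

lemma tcong_sum: "(\<And>x. x \<in> X \<Longrightarrow> tcong L (f x) (g x)) \<Longrightarrow> tcong L (sum f X) (sum g X)"
  unfolding tcong_def by (auto simp: coeff_sum intro!: cong_sum)

lemma tcong_prod: "(\<And>x. x \<in> X \<Longrightarrow> tcong L (f x) (g x)) \<Longrightarrow> tcong L (prod f X) (prod g X)"
  by (induction X rule: infinite_finite_induct) (auto intro: tcong_mult)

lemma zcong_refl [simp]: "zcong L p p"
  by (simp add: zcong_def)

lemma zcong_mult: "zcong L p r \<Longrightarrow> zcong L p' r' \<Longrightarrow> zcong L (p * p') (r * r')"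
  unfolding zcong_def by (auto simp: coeff_mult intro!: tcong_sum tcong_mult)

lemma zcong_smult: "tcong L f g \<Longrightarrow> zcong L p r \<Longrightarrow> zcong L (smult f p) (smult g r)"
  unfolding zcong_def by (auto intro: tcong_mult)

lemma zcong_prod: "(\<And>x. x \<in> X \<Longrightarrow> zcong L (f x) (g x)) \<Longrightarrow> zcong L (prod f X) (prod g X)"
  by (induction X rule: infinite_finite_induct) (auto intro: zcong_mult)

lemma zcong_power: "zcong L p r \<Longrightarrow> zcong L (p ^ k) (r ^ k)"
  by (induction k) (auto intro: zcong_mult)

text \<open>The inner binomial coefficients of a prime power are divisible by the prime. An
  arbitrary commutative ring is allowed because the fact is needed both for polynomials in q and for
  polynomials in z over them.\<close>

lemma five_dvd_add_power5: "5 dvd (a + b) ^ 5 - (a ^ 5 + b ^ 5 :: 'a :: comm_ring_1)"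
proof -
  have "(5 :: 'a) dvd (\<Sum>k\<in>{1..<5}. of_nat (5 choose k) * a ^ k * b ^ (5 - k))"
  proof (rule dvd_sum)
    fix k :: nat assume "k \<in> {1..<5}"
    then have "5 dvd (5 choose k)" by (intro dvd_choose_prime) auto
    then obtain c where "5 choose k = 5 * c" ..
    then show "(5 :: 'a) dvd of_nat (5 choose k) * a ^ k * b ^ (5 - k)"
      by (simp add: mult.assoc)
  qed
  moreover have "{..5} = insert 0 (insert 5 {1..<5 :: nat})" by auto
  ultimately show ?thesis by (simp add: binomial_ring)
qed

lemma five_dvd_polyD: "5 dvd p \<Longrightarrow> 5 dvd coeff p i" for p :: "'a :: comm_ring_1 poly"
proof -
  assume "5 dvd p"
  then obtain r where "p = 5 * r" ..
  then show ?thesis by (simp add: numeral_poly)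
qed

lemma tcong_add_power5: "tcong L ((f + g) ^ 5) (f ^ 5 + g ^ 5)"
  unfolding tcong_def cong_iff_dvd_diff
  using five_dvd_polyD[OF five_dvd_add_power5[of f g]] by simp

lemma zcong_add_power5: "zcong L ((p + r) ^ 5) (p ^ 5 + r ^ 5)"
  unfolding zcong_def tcong_def cong_iff_dvd_diff
  using five_dvd_polyD[OF five_dvd_polyD[OF five_dvd_add_power5[of p r]]] by simp

lemma cong_diff_multiple_nat: "d dvd j \<Longrightarrow> j \<le> i \<Longrightarrow> [i - j = i] (mod d)" for i :: nat
  using cong_add_lcancel_0_nat[of "i - j" j d] by (auto simp: cong_0_iff intro: cong_sym)

text \<open>Strong induction on \<open>i\<close>: only shifts \<open>j\<close> divisible by
  \<open>d\<close> contribute to the convolution, so every other coefficient of \<open>Z\<close>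
  involved has a smaller index in the same residue class. \<open>d = 1\<close> is ordinary
  cancellation; \<open>d = 5\<close> later removes a series in q^5 while looking at one class
  only.\<close>

lemma coeff_mult_cancel_cong:
  fixes A Z :: "int poly"
  assumes A0: "coprime (coeff A 0) 5"
    and supp: "\<And>i. \<not> d dvd i \<Longrightarrow> coeff A i = 0"
    and AZ: "\<And>i. i \<le> L \<Longrightarrow> [i = r] (mod d) \<Longrightarrow> 5 dvd coeff (A * Z) i"
    and i: "i \<le> L" "[i = r] (mod d)"
  shows "5 dvd coeff Z i"
  using i
proof (induction i rule: less_induct)
  case (less i)
  have "coeff (A * Z) i = coeff A 0 * coeff Z i + (\<Sum>j\<in>{..i}-{0}. coeff A j * coeff Z (i - j))"
    by (simp add: coeff_mult sum.remove[of "{..i}" 0])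
  moreover have "5 dvd (\<Sum>j\<in>{..i}-{0}. coeff A j * coeff Z (i - j))"
  proof (rule dvd_sum)
    fix j assume j: "j \<in> {..i} - {0}"
    show "5 dvd coeff A j * coeff Z (i - j)"
    proof (cases "d dvd j")
      case True
      then have "[i - j = r] (mod d)"
        using j less.prems(2) cong_trans[OF cong_diff_multiple_nat[of d j i]] by auto
      then show ?thesis using less j by auto
    qed (simp add: supp)
  qed
  ultimately have "5 dvd coeff A 0 * coeff Z i"
    using AZ[OF less.prems] by (simp add: dvd_add_left_iff)
  then show ?case
    using A0 by (simp add: coprime_commute coprime_dvd_mult_right_iff)
qed

lemma tcong_mult_cancel:
  assumes "coeff A 0 = 1" "tcong L (A * f) (A * g)"
  shows "tcong L f g"
proof -
  have "5 dvd coeff (f - g) i" if "i \<le> L" for i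
    using that assms coeff_mult_cancel_cong[of A 1 L 0 "f - g" i]
    by (simp add: tcong_def cong_iff_dvd_diff right_diff_distrib)
  then show ?thesis by (simp add: tcong_def cong_iff_dvd_diff)
qed

subsection \<open>The finite Jacobi triple product\<close>

definition qpoch :: "nat \<Rightarrow> int poly" where
  "qpoch n = (\<Prod>i<n. 1 - monom 1 (i + 1))"

text \<open>\<open>qz a e\<close> is the monomial \<open>z^a q^e\<close>.\<close>

definition qz :: "nat \<Rightarrow> nat \<Rightarrow> int poly poly" where
  "qz a e = monom (monom 1 e) a"

text \<open>For \<open>m = n\<close> this is the truncated triple product times \<open>z^n\<close>, which clears the negative powers
  of \<open>z\<close>; coefficient \<open>k\<close> thus belongs to \<open>z^(k-n)\<close>.\<close>

definition jtp :: "nat \<Rightarrow> nat \<Rightarrow> int poly poly" where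
  "jtp m n = (\<Prod>i<m. 1 + qz 1 (i + 1)) * (\<Prod>i<n. qz 1 0 + qz 0 i)"

definition tri :: "int \<Rightarrow> nat" where
  "tri j = nat (j * (j + 1) div 2)"

text \<open>A product of two consecutive integers is even and nonnegative, so neither
  \<open>div\<close> nor \<open>nat\<close> truncates, even for negative \<open>j\<close>.\<close>

lemma int_tri: "2 * int (tri j) = j * (j + 1)"
proof -
  have "0 \<le> j * (j + 1)" by (cases "0 \<le> j") (auto intro: mult_nonpos_nonpos)
  moreover have "even (j * (j + 1))" by simp
  ultimately show ?thesis by (simp add: tri_def)
qed

lemma tri_diff: "int (tri j) = int (tri (j - 1)) + j"
  using int_tri[of j] int_tri[of "j - 1"] by (simp add: algebra_simps)

text \<open>Terms surviving modulo q^(L+1) thus have |j| at most L + 1, which keeps them away from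
  both ends of a long enough finite product.\<close>

lemma abs_le_tri: "\<bar>j\<bar> \<le> int (tri j) + 1"
proof -
  have "2 * \<bar>j\<bar> \<le> j * (j + 1) + 2"
  proof (cases "j \<in> {-2..1}")
    case True
    then have "j = -2 \<or> j = -1 \<or> j = 0 \<or> j = 1" by auto
    then show ?thesis by auto
  next
    case False
    show ?thesis
    proof (cases "j \<ge> 2")
      case True
      then have "2 * j \<le> (j + 1) * j" by (intro mult_right_mono[of 2 "j + 1" j]) auto
      moreover have "(j + 1) * j = j * (j + 1)" by (rule mult.commute)
      ultimately show ?thesis using True by linarith
    next
      case False
      with \<open>j \<notin> {-2..1}\<close> have "j \<le> -3" by auto
      then have "2 * (- j) \<le> (- j - 1) * (- j)" by (intro mult_right_mono[of 2 "- j - 1" "- j"]) auto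
      moreover have "(- j - 1) * (- j) = j * (j + 1)" by (simp add: algebra_simps)
      ultimately show ?thesis using \<open>j \<le> -3\<close> by linarith
    qed
  qed
  then show ?thesis using int_tri[of j] by linarith
qed

lemma qpoch_0 [simp]: "qpoch 0 = 1"
  by (simp add: qpoch_def)

lemma qpoch_Suc: "qpoch (Suc n) = (1 - monom 1 (Suc n)) * qpoch n"
  by (simp add: qpoch_def mult.commute)

lemma coeff_qpoch_0 [simp]: "coeff (qpoch n) 0 = 1"
  by (induction n) (simp_all add: qpoch_Suc coeff_mult coeff_monom)

lemma qz_mult: "qz a e * qz b f = qz (a + b) (e + f)"
  by (simp add: qz_def mult_monom)

lemma qz_0_0 [simp]: "qz 0 0 = 1"
  by (simp add: qz_def)

lemma qz_power: "qz a e ^ k = qz (k * a) (k * e)"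
  by (induction k) (simp_all add: qz_mult)

lemma coeff_coeff_qz: "coeff (coeff (qz a e) j) i = (if a = j \<and> e = i then 1 else 0)"
  by (simp add: qz_def coeff_monom)

lemma jtp_0_0 [simp]: "jtp 0 0 = 1"
  by (simp add: jtp_def)

lemma jtp_Suc_left: "jtp (Suc m) n = jtp m n + monom (monom 1 (m + 1)) 1 * jtp m n"
  by (simp add: jtp_def qz_def algebra_simps)

lemma jtp_Suc_right: "jtp m (Suc n) = monom 1 1 * jtp m n + smult (monom 1 n) (jtp m n)"
  by (simp add: jtp_def qz_def algebra_simps monom_0)

lemma coeff_jtp_eq_0: "m + n < k \<Longrightarrow> coeff (jtp m n) k = 0"
proof (induction m arbitrary: k)
  case 0
  then show ?case
    by (induction n arbitrary: k) (simp_all add: jtp_Suc_right coeff_monom_mult coeff_eq_0)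
next
  case (Suc m)
  then show ?case by (simp add: jtp_Suc_left coeff_monom_mult)
qed

text \<open>The q-Pascal step shared by the two inductions of \<open>coeff_jtp\<close>:
  \<open>N\<close> is the old number of factors and \<open>u\<close>, \<open>v\<close> are the
  q-exponents of the new factor. At the boundary, the missing neighbour is matched by 1 - q^0 =
  0.\<close>

lemma coeff_jtp_step:
  assumes ck: "k \<le> N \<Longrightarrow> qpoch k * qpoch (N - k) * c k = monom 1 t * qpoch N"
    and ck1: "\<And>l. k = Suc l \<Longrightarrow> l \<le> N \<Longrightarrow> qpoch l * qpoch (N - l) * c l = monom 1 s * qpoch N"
    and cN: "c (Suc N) = 0"
    and k: "k \<le> Suc N"
    and c'0: "k = 0 \<Longrightarrow> c' = monom 1 u * c 0"
    and c'Suc: "\<And>l. k = Suc l \<Longrightarrow> c' = monom 1 u * c k + monom 1 v * c l"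
  shows "qpoch k * qpoch (Suc N - k) * c' =
    (monom 1 (u + t) * (1 - monom 1 (Suc N - k)) + monom 1 (v + s) * (1 - monom 1 k)) * qpoch N"
proof -
  have A: "qpoch k * qpoch (Suc N - k) * c k = (1 - monom 1 (Suc N - k)) * monom 1 t * qpoch N"
  proof (cases "k \<le> N")
    case True
    then have "qpoch (Suc N - k) = (1 - monom 1 (Suc N - k)) * qpoch (N - k)"
      using qpoch_Suc[of "N - k"] by (simp add: Suc_diff_le)
    then show ?thesis using ck[OF True] by (simp add: mult_ac)
  next
    case False
    with k have "k = Suc N" by simp
    then show ?thesis using cN by simp
  qed
  show ?thesis
  proof (cases k)
    case 0
    have "monom 1 (u + t) = monom 1 u * (monom 1 t :: int poly)" by (simp add: mult_monom)
    then show ?thesis using 0 A c'0 by (simp add: mult_ac)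
  next
    case (Suc l)
    then have "qpoch k * qpoch (Suc N - k) * c l = (1 - monom 1 k) * monom 1 s * qpoch N"
      using ck1[of l] k by (simp add: qpoch_Suc mult_ac)
    note B = this
    have "qpoch k * qpoch (Suc N - k) * c' = monom 1 u * (qpoch k * qpoch (Suc N - k) * c k)
        + monom 1 v * (qpoch k * qpoch (Suc N - k) * c l)"
      unfolding c'Suc[OF Suc] by (simp only: distrib_left mult_ac)
    also have "\<dots> = (monom 1 u * monom 1 t * (1 - monom 1 (Suc N - k))
        + monom 1 v * monom 1 s * (1 - monom 1 k)) * qpoch N"
      unfolding A B by (simp only: distrib_left mult_ac)
    finally show ?thesis by (simp add: mult_monom)
  qed
qed

text \<open>The finite triple product: the coefficient is a Gaussian binomial times a power of q,
  with denominators cleared to stay within polynomials.\<close>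

lemma coeff_jtp:
  "k \<le> m + n \<Longrightarrow> qpoch k * qpoch (m + n - k) * coeff (jtp m n) k
     = monom 1 (tri (int k - int n)) * qpoch (m + n)"
proof (induction m arbitrary: k)
  case 0
  then show ?case
  proof (induction n arbitrary: k)
    case 0
    then show ?case by (simp add: tri_def)
  next
    case (Suc n)
    let ?t = "tri (int k - int n)" and ?s = "tri (int k - int (Suc n))"
    \<comment> \<open>These exponent identities cancel the two mixed terms of the q-Pascal step,
      leaving a multiple of 1 - q^(n+1).\<close>
    have e: "n + ?t = ?s + k" "n + ?t + (Suc n - k) = ?s + Suc n"
      using tri_diff[of "int k - int n"] Suc.prems by (auto simp: algebra_simps)
    have "qpoch k * qpoch (Suc n - k) * coeff (jtp 0 (Suc n)) k =
      (monom 1 (n + ?t) * (1 - monom 1 (Suc n - k)) + monom 1 (0 + ?s) * (1 - monom 1 k)) * qpoch n"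
      by (rule coeff_jtp_step[where c = "coeff (jtp 0 n)"])
        (use Suc coeff_jtp_eq_0[of 0 n "Suc n"] in \<open>auto simp: jtp_Suc_right coeff_monom_mult\<close>)
    also have "\<dots> = monom 1 ?s * qpoch (Suc n)"
      using e by (simp add: qpoch_Suc algebra_simps mult_monom)
    finally show ?case by simp
  qed
next
  case (Suc m)
  let ?t = "tri (int k - int n)" and ?s = "tri (int k - 1 - int n)"
  have e: "?t + (Suc (m + n) - k) = Suc m + ?s" "?t + Suc (m + n) = Suc m + ?s + k"
    using tri_diff[of "int k - int n"] Suc.prems by (auto simp: algebra_simps)
  have "qpoch k * qpoch (Suc (m + n) - k) * coeff (jtp (Suc m) n) k =
    (monom 1 (0 + ?t) * (1 - monom 1 (Suc (m + n) - k)) + monom 1 (Suc m + ?s) * (1 - monom 1 k))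
      * qpoch (m + n)"
    by (rule coeff_jtp_step[where c = "coeff (jtp m n)"])
      (use Suc coeff_jtp_eq_0[of m n "Suc (m + n)"] in \<open>auto simp: jtp_Suc_left coeff_monom_mult\<close>)
  also have "\<dots> = monom 1 ?t * qpoch (Suc (m + n))"
    using e by (simp add: qpoch_Suc algebra_simps mult_monom)
  finally show ?case by simp
qed

text \<open>Factors 1 - q^i with i > L are 1 modulo q^(L+1).\<close>

lemma tcong_qpoch:
  assumes "L \<le> m" "L \<le> n"
  shows "tcong L (qpoch m) (qpoch n)"
proof -
  have *: "tcong L (qpoch (L + d)) (qpoch L)" for d
  proof (induction d)
    case (Suc d)
    have "tcong L (1 - monom 1 (Suc (L + d))) 1"
      by (auto simp: tcong_def coeff_monom)
    from tcong_mult[OF this Suc] show ?case by (simp add: qpoch_Suc)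
  qed simp
  show ?thesis
    using *[of "m - L"] *[of "n - L"] assms by (auto intro: tcong_trans tcong_sym)
qed

lemma tcong_monom_0: "L < t \<Longrightarrow> tcong L (monom c t) 0"
  by (auto simp: tcong_def coeff_monom)

text \<open>The limit form of the triple product. If the exponent is at most \<open>L\<close>, all
  three Pochhammer factors in \<open>coeff_jtp\<close> agree with \<open>qpoch K\<close> and one of
  them cancels; otherwise both sides vanish.\<close>

lemma qpoch_mult_coeff_jtp:
  assumes M: "2 * L + 1 \<le> m" "2 * L + 1 \<le> n" and k: "k \<le> m + n" and K: "L \<le> K"
  shows "tcong L (qpoch K * coeff (jtp m n) k) (monom 1 (tri (int k - int n)))"
proof (cases "tri (int k - int n) \<le> L")
  case True
  then have "\<bar>int k - int n\<bar> \<le> int L + 1"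
    using abs_le_tri[of "int k - int n"] by linarith
  \<comment> \<open>The bound 2L + 1 = L + (L + 1) leaves room for \<open>L\<close> factors on
    either side.\<close>
  with M have "L \<le> k" "L \<le> m + n - k" by linarith+
  then have "tcong L (qpoch K * qpoch K * coeff (jtp m n) k) (qpoch k * qpoch (m + n - k) * coeff (jtp m n) k)"
    using K by (intro tcong_mult tcong_qpoch) auto
  also have "\<dots> = monom 1 (tri (int k - int n)) * qpoch (m + n)"
    by (rule coeff_jtp[OF k])
  also have "tcong L \<dots> (monom 1 (tri (int k - int n)) * qpoch K)"
    using M K by (intro tcong_mult tcong_qpoch) auto
  finally have "tcong L (qpoch K * (qpoch K * coeff (jtp m n) k)) (qpoch K * monom 1 (tri (int k - int n)))"
    by (simp add: mult_ac)
  then show ?thesis by (rule tcong_mult_cancel[rotated]) simp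
next
  case False
  have "tcong L (qpoch k * qpoch (m + n - k) * coeff (jtp m n) k) (0 * qpoch (m + n))"
    unfolding coeff_jtp[OF k] using False by (intro tcong_mult tcong_monom_0) auto
  then have "tcong L (coeff (jtp m n) k) 0"
    by (intro tcong_mult_cancel[of "qpoch k * qpoch (m + n - k)" L "coeff (jtp m n) k" 0])
      (auto simp: coeff_mult)
  then have "tcong L (qpoch K * coeff (jtp m n) k) (qpoch K * 0)"
    by (intro tcong_mult) auto
  also have "tcong L (qpoch K * 0) (monom 1 (tri (int k - int n)))"
    using False by (intro tcong_sym[of L "monom 1 _"]) (auto intro: tcong_monom_0)
  finally show ?thesis .
qed

subsection \<open>The generating function of \<open>c\<phi>\<^sub>k\<close>\<close>

text \<open>Rows decrease, so the reversed order is the one in which they are sorted lists in the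
  library's sense.\<close>

lemma linorder_colored_greater:
  "class.linorder (\<lambda>x y. y \<prec> x \<or> x = y) (\<lambda>x y. y \<prec> x)"
  by unfold_locales (auto simp: colored_less_def)

lemma frobenius_row_alt:
  "frobenius_row k xs \<longleftrightarrow> (\<forall>x\<in>set xs. snd x \<in> {1..k}) \<and>
     sorted_wrt (\<lambda>x y. y \<prec> x \<or> x = y) xs \<and> distinct xs"
  unfolding frobenius_row_def linorder.strict_sorted_iff[OF linorder_colored_greater] ..

lemma frobenius_row_unique:
  "frobenius_row k xs \<Longrightarrow> frobenius_row k ys \<Longrightarrow> set xs = set ys \<Longrightarrow> xs = ys"
  unfolding frobenius_row_alt
  using linorder.sorted_distinct_set_unique[OF linorder_colored_greater] by blast

lemma frobenius_row_exists:
  assumes "finite X" "X \<subseteq> UNIV \<times> {1..k}"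
  obtains xs where "frobenius_row k xs" "set xs = X"
proof -
  obtain xs where "set xs = X \<and> sorted_wrt (\<lambda>x y. y \<prec> x \<or> x = y) xs \<and> distinct xs"
    using linorder.finite_sorted_distinct_unique[OF linorder_colored_greater assms(1)] by blast
  then show ?thesis using assms(2) that[of xs] by (fastforce simp: frobenius_row_alt)
qed

text \<open>A strictly decreasing row is determined by its set of entries. The number of columns is
  charged as 1 to each top entry, and weight \<open>n\<close> forces all integer values below
  \<open>M\<close>.\<close>

lemma card_frobenius_partitions:
  assumes "n < M"
  shows "cphi k n = card {(X, Y). X \<subseteq> {..<M} \<times> {1..k} \<and> Y \<subseteq> {..<M} \<times> {1..k} \<and>
    card X = card Y \<and> (\<Sum>x\<in>X. fst x + 1) + sum fst Y = n}" (is "_ = card ?P")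
proof -
  have row: "card (set xs) = length xs" "sum fst (set xs) = sum_list (map fst xs)"
    "(\<Sum>x\<in>set xs. fst x + 1) = length xs + sum_list (map fst xs)"
    if "frobenius_row k xs" for xs
    using that by (simp_all add: frobenius_row_alt distinct_card sum_Suc sum_list_distinct_conv_sum_set)
  have "bij_betw (map_prod set set) (frobenius_partitions k n) ?P"
    unfolding bij_betw_def
  proof (intro conjI subset_antisym subsetI)
    show "inj_on (map_prod set set) (frobenius_partitions k n)"
      by (auto simp: inj_on_def frobenius_partitions_def frobenius_symbol_def
          intro: frobenius_row_unique)
  next
    fix Q assume "Q \<in> map_prod set set ` frobenius_partitions k n"
    then obtain xs ys where Q: "Q = (set xs, set ys)" "frobenius_row k xs" "frobenius_row k ys"
      "length xs = length ys" "length xs + sum_list (map fst xs) + sum_list (map fst ys) = n"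
      by (auto simp: frobenius_partitions_def frobenius_symbol_def frobenius_weight_def)
    have "fst x \<le> sum_list (map fst zs)" if "x \<in> set zs" for x and zs :: "colored_nat list"
      using that by (intro member_le_sum_list) auto
    then have "fst x < M" if "x \<in> set xs \<union> set ys" for x
      using that Q(5) assms by fastforce
    then have "set xs \<union> set ys \<subseteq> {..<M} \<times> {1..k}"
      using Q(2,3) unfolding frobenius_row_def by (fastforce simp: mem_Times_iff)
    then show "Q \<in> ?P"
      unfolding Q(1) using Q(4,5) row[OF Q(2)] row[OF Q(3)] by simp
  next
    fix Q assume "Q \<in> ?P"
    then obtain X Y where Q: "Q = (X, Y)" "X \<subseteq> {..<M} \<times> {1..k}" "Y \<subseteq> {..<M} \<times> {1..k}"
      "card X = card Y" "(\<Sum>x\<in>X. fst x + 1) + sum fst Y = n" by auto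
    have "finite X" "finite Y"
      using finite_subset[OF Q(2)] finite_subset[OF Q(3)] by simp_all
    obtain xs where xs: "frobenius_row k xs" "set xs = X"
      by (rule frobenius_row_exists[OF \<open>finite X\<close>, of k]) (use Q(2) in auto)
    obtain ys where ys: "frobenius_row k ys" "set ys = Y"
      by (rule frobenius_row_exists[OF \<open>finite Y\<close>, of k]) (use Q(3) in auto)
    have "(xs, ys) \<in> frobenius_partitions k n"
      using Q(4,5) xs ys row[OF xs(1)] row[OF ys(1)]
      by (simp add: frobenius_partitions_def frobenius_symbol_def frobenius_weight_def)
    then show "Q \<in> map_prod set set ` frobenius_partitions k n"
      using Q xs ys by force
  qed
  then show ?thesis unfolding cphi_def by (rule bij_betw_same_card)
qed

lemma prod_qz: "(\<Prod>x\<in>X. qz (f x) (g x)) = qz (sum f X) (sum g X)"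
  by (induction X rule: infinite_finite_induct) (auto simp: qz_mult)

lemma prod_Times_fst: "(\<Prod>x\<in>A \<times> B. f (fst x)) = (\<Prod>x\<in>A. f x) ^ card B"
  for f :: "'a \<Rightarrow> 'c :: comm_semiring_1"
  using prod.cartesian_product[of "\<lambda>x _. f x" B A]
  by (simp add: prod_power_distrib case_prod_beta)

text \<open>Expanding the products, \<open>X\<close> collects the factors contributing z q^(l+1) and
  \<open>Y\<close> those contributing q^l; the factors outside \<open>Y\<close> contribute
  z.\<close>

lemma jtp_power:
  "jtp M M ^ k = (\<Sum>X\<in>Pow ({..<M} \<times> {1..k}). \<Sum>Y\<in>Pow ({..<M} \<times> {1..k}).
     qz (card X + (M * k - card Y)) ((\<Sum>x\<in>X. fst x + 1) + sum fst Y))"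
proof -
  let ?I = "{..<M} \<times> {1..k}"
  have "(\<Prod>i<M. 1 + qz 1 (i + 1)) ^ k = (\<Prod>x\<in>?I. qz 1 (fst x + 1) + 1)"
    using prod_Times_fst[of "\<lambda>i. 1 + qz 1 (i + 1)" "{..<M}" "{1..k}"] by (simp add: add.commute)
  also have "\<dots> = (\<Sum>X\<in>Pow ?I. qz (card X) (\<Sum>x\<in>X. fst x + 1))"
    by (subst prod_add) (simp_all add: prod_qz)
  finally have 1: "(\<Prod>i<M. 1 + qz 1 (i + 1)) ^ k = \<dots>" .
  have "(\<Prod>i<M. qz 1 0 + qz 0 i) ^ k = (\<Prod>x\<in>?I. qz 0 (fst x) + qz 1 0)"
    using prod_Times_fst[of "\<lambda>i. qz 1 0 + qz 0 i" "{..<M}" "{1..k}"] by (simp add: add.commute)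
  also have "\<dots> = (\<Sum>Y\<in>Pow ?I. qz (card (?I - Y)) (sum fst Y))"
    by (subst prod_add) (simp_all add: prod_qz qz_mult qz_power)
  also have "\<dots> = (\<Sum>Y\<in>Pow ?I. qz (M * k - card Y) (sum fst Y))"
    by (intro sum.cong refl) (auto simp: card_Diff_subset finite_subset)
  finally have 2: "(\<Prod>i<M. qz 1 0 + qz 0 i) ^ k = \<dots>" .
  show ?thesis
    unfolding jtp_def power_mult_distrib 1 2 by (simp add: sum_product qz_mult)
qed

text \<open>Each of the \<open>k\<close> factors carries a shift by z^M, so z^(M k) stands for z^0
  and selects the pairs with \<open>card X = card Y\<close>.\<close>

lemma cphi_eq_coeff:
  assumes "n < M"
  shows "int (cphi k n) = coeff (coeff (jtp M M ^ k) (M * k)) n"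
proof -
  let ?I = "{..<M} \<times> {1..k}"
  have le: "card Y \<le> M * k" if "Y \<in> Pow ?I" for Y
    using that card_mono[of ?I Y] by auto
  have "coeff (coeff (jtp M M ^ k) (M * k)) n =
    (\<Sum>X\<in>Pow ?I. \<Sum>Y\<in>Pow ?I. of_bool (card X = card Y \<and> (\<Sum>x\<in>X. fst x + 1) + sum fst Y = n))"
    unfolding jtp_power coeff_sum
  proof (intro sum.cong refl)
    fix X Y assume "Y \<in> Pow ?I"
    then show "coeff (coeff (qz (card X + (M * k - card Y)) ((\<Sum>x\<in>X. fst x + 1) + sum fst Y)) (M * k)) n
      = of_bool (card X = card Y \<and> (\<Sum>x\<in>X. fst x + 1) + sum fst Y = n)"
      using le[of Y] unfolding coeff_coeff_qz by auto
  qed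
  also have "\<dots> = (\<Sum>(X, Y)\<in>Pow ?I \<times> Pow ?I. of_bool (card X = card Y \<and> (\<Sum>x\<in>X. fst x + 1) + sum fst Y = n))"
    by (rule sum.cartesian_product)
  also have "\<dots> = int (card (Pow ?I \<times> Pow ?I \<inter>
      {(X, Y). card X = card Y \<and> (\<Sum>x\<in>X. fst x + 1) + sum fst Y = n}))"
    unfolding case_prod_beta
    by (rule sum_of_bool_eq) (intro finite_cartesian_product finite_Pow_iff[THEN iffD2], auto)
  also have "Pow ?I \<times> Pow ?I \<inter> {(X, Y). card X = card Y \<and> (\<Sum>x\<in>X. fst x + 1) + sum fst Y = n}
    = {(X, Y). X \<subseteq> ?I \<and> Y \<subseteq> ?I \<and> card X = card Y \<and> (\<Sum>x\<in>X. fst x + 1) + sum fst Y = n}"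
    by auto
  also have "int (card \<dots>) = int (cphi k n)"
    using card_frobenius_partitions[OF assms] by simp
  finally show ?thesis by simp
qed

subsection \<open>The cube of the Euler product and the congruence\<close>

lemma pderiv_sum: "pderiv (sum f X) = (\<Sum>x\<in>X. pderiv (f x))"
  by (induction X rule: infinite_finite_induct) (simp_all add: pderiv_add)

text \<open>Differentiate \<open>jtp M (Suc M)\<close> at its root \<open>z = -1\<close>. Adding a multiple of the vanishing value
  at the root turns the weight \<open>k\<close> into \<open>2k - 2M - 1\<close>, so that no pairing of terms is needed.\<close>

lemma coeff_jtp_altsum:
  "(\<Sum>k\<le>2 * M + 1. of_int ((2 * int k - 2 * int M - 1) * (-1) ^ (k + 1)) * coeff (jtp M (Suc M)) k)
     = 2 * (-1) ^ M * qpoch M ^ 2"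
proof -
  let ?J = "jtp M (Suc M)"
  \<comment> \<open>The factor \<open>i = 0\<close> of the second product is z + 1. With it split
    off, the derivative at -1 is just the value of \<open>Q\<close> there.\<close>
  define Q where "Q = (\<Prod>i<M. 1 + qz 1 (i + 1)) * (\<Prod>i<M. qz 1 0 + qz 0 (i + 1))"
  have "?J = (qz 1 0 + 1) * Q"
    unfolding jtp_def Q_def by (simp add: prod.lessThan_Suc_shift mult_ac del: prod.lessThan_Suc)
  then have J: "?J = [:1, 1:] * Q"
    by (simp add: qz_def monom_altdef one_pCons)
  have neg: "(\<Prod>i<m. - g i) = (-1) ^ m * (\<Prod>i<m. g i)" for g :: "nat \<Rightarrow> int poly" and m
    by (induction m) simp_all
  have "poly Q (-1) = (\<Prod>i<M. 1 - monom 1 (i + 1)) * (\<Prod>i<M. - (1 - monom 1 (i + 1)))"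
    by (simp add: Q_def poly_prod qz_def poly_monom)
  also have "\<dots> = (-1) ^ M * qpoch M ^ 2"
    unfolding neg qpoch_def by (simp add: power2_eq_square)
  finally have Q: "poly Q (-1) = (-1) ^ M * qpoch M ^ 2" .
  have J': "?J = (\<Sum>k\<le>2 * M + 1. monom (coeff ?J k) k)"
    by (rule poly_as_sum_of_monoms'[symmetric], rule degree_le) (auto intro: coeff_jtp_eq_0)
  have 1: "poly ?J (-1) = (\<Sum>k\<le>2 * M + 1. (-1) ^ k * coeff ?J k)"
    by (subst J') (simp add: poly_sum poly_monom mult.commute)
  have 2: "poly (pderiv ?J) (-1) = (\<Sum>k\<le>2 * M + 1. - (of_nat k * (-1) ^ k * coeff ?J k))"
  proof (subst J', simp only: pderiv_sum poly_sum pderiv_monom poly_monom, intro sum.cong refl)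
    fix k show "of_nat k * coeff ?J k * (-1) ^ (k - 1) = - (of_nat k * (-1) ^ k * coeff ?J k)"
      by (cases k) (simp_all add: mult_ac)
  qed
  have "(\<Sum>k\<le>2 * M + 1. of_int ((2 * int k - 2 * int M - 1) * (-1) ^ (k + 1)) * coeff ?J k)
     = 2 * poly (pderiv ?J) (-1) + of_int (2 * int M + 1) * poly ?J (-1)"
    unfolding 1 2 by (simp add: sum_distrib_left sum.distrib[symmetric] algebra_simps
       del: sum.atMost_Suc)
  also have "poly ?J (-1) = 0" by (simp add: J)
  also have "poly (pderiv ?J) (-1) = (-1) ^ M * qpoch M ^ 2"
    unfolding J pderiv_mult by (simp add: pderiv_pCons Q)
  finally show ?thesis by simp
qed

text \<open>Jacobi's theta series cut to |a| <= M, with the same shift by z^M as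
  \<open>jtp M M\<close>.\<close>

definition theta :: "nat \<Rightarrow> int poly poly" where
  "theta M = (\<Sum>k\<le>2 * M. qz k (tri (int k - int M)))"

text \<open>With w = k - M - 1 this is (-1)^M times the sum of (-1)^w (2w+1) q^(w(w+1)/2). The range
  of w is symmetric under w -> -1-w, whence the factor 2 in \<open>qpoch_cube\<close>.\<close>

definition jacobi_cube :: "nat \<Rightarrow> int poly" where
  "jacobi_cube M = (\<Sum>k\<le>2 * M + 1.
     monom ((2 * int k - 2 * int M - 1) * (-1) ^ (k + 1)) (tri (int k - int M - 1)))"

lemma qpoch_smult_jtp:
  assumes "2 * L + 1 \<le> M"
  shows "zcong L (smult (qpoch M) (jtp M M)) (theta M)"
  unfolding zcong_def
proof
  fix k
  have [simp]: "coeff (theta M) k = (if k \<le> 2 * M then monom 1 (tri (int k - int M)) else 0)"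
    by (simp add: theta_def coeff_sum qz_def coeff_monom)
  show "tcong L (coeff (smult (qpoch M) (jtp M M)) k) (coeff (theta M) k)"
    using qpoch_mult_coeff_jtp[of L M M k M] coeff_jtp_eq_0[of M M k] assms by simp
qed

text \<open>Jacobi's identity: one more factor \<open>qpoch M\<close> in
  \<open>coeff_jtp_altsum\<close> turns each coefficient into a pure power of q by the triple
  product.\<close>

lemma qpoch_cube:
  assumes "2 * L + 1 \<le> M"
  shows "tcong L (2 * (-1) ^ M * qpoch M ^ 3) (jacobi_cube M)"
proof -
  have "2 * (-1) ^ M * qpoch M ^ 3 = (2 * (-1) ^ M * qpoch M ^ 2) * qpoch M"
    by (simp add: power3_eq_cube power2_eq_square mult_ac)
  also have "\<dots> = (\<Sum>k\<le>2 * M + 1. of_int ((2 * int k - 2 * int M - 1) * (-1) ^ (k + 1)) *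
      (qpoch M * coeff (jtp M (Suc M)) k))"
    unfolding coeff_jtp_altsum[symmetric] sum_distrib_right by (simp only: mult_ac)
  also have "tcong L \<dots> (\<Sum>k\<le>2 * M + 1. of_int ((2 * int k - 2 * int M - 1) * (-1) ^ (k + 1)) *
      monom 1 (tri (int k - int (Suc M))))"
    using assms by (intro tcong_sum tcong_mult tcong_refl qpoch_mult_coeff_jtp) auto
  also have "\<dots> = jacobi_cube M"
    unfolding jacobi_cube_def by (intro sum.cong refl)
      (simp add: of_int_poly smult_monom algebra_simps del: of_int_mult of_int_power)
  finally show ?thesis .
qed

section \<open>The quadratic obstruction modulo 5\<close>

lemma five_dvd_square_diff:
  fixes x y :: int
  assumes "5 dvd x\<^sup>2 - 2 * y\<^sup>2"
  shows "5 dvd x"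
proof -
  define a b where "a = x mod 5" and "b = y mod 5"
  have "[a\<^sup>2 - 2 * b\<^sup>2 = x\<^sup>2 - 2 * y\<^sup>2] (mod 5)"
    by (intro cong_diff cong_mult cong_pow cong_refl) (simp_all add: a_def b_def cong_def)
  then have "5 dvd a\<^sup>2 - 2 * b\<^sup>2" using assms by (simp add: cong_dvd_iff)
  moreover have "a \<in> {0..4}" "b \<in> {0..4}" by (simp_all add: a_def b_def)
  then have "a = 0 \<or> a = 1 \<or> a = 2 \<or> a = 3 \<or> a = 4" "b = 0 \<or> b = 1 \<or> b = 2 \<or> b = 3 \<or> b = 4"
    by auto
  ultimately have "a = 0" by auto
  then show ?thesis by (simp add: a_def dvd_eq_mod_eq_0)
qed

lemma five_dvd_odd_of_tri_sum:
  fixes x y w :: int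
  assumes xy: "5 dvd x + y" and i: "[tri x + tri y + tri w = 3] (mod 5)"
  shows "5 dvd 2 * w + 1"
proof -
  from i have "[int (tri x + tri y + tri w) = int 3] (mod int 5)"
    by (simp only: cong_int_iff)
  then obtain c where "int (tri x + tri y + tri w) - 3 = 5 * c"
    by (auto simp: cong_iff_dvd_diff elim: dvdE)
  then have e: "x * (x + 1) + y * (y + 1) + w * (w + 1) = 10 * c + 6"
    using int_tri[of x] int_tri[of y] int_tri[of w] by linarith
  obtain d where "x + y = 5 * d" using xy ..
  then have y: "y = 5 * d - x" by simp
  \<comment> \<open>Multiply \<open>e\<close> by 4, add 1 to complete the square in w, and
    substitute y, which is -x modulo 5.\<close>
  have "(2 * w + 1)\<^sup>2 - 2 * x\<^sup>2 = 5 * (8 * c + 5 - 2 * x\<^sup>2 - 20 * d\<^sup>2 + 8 * d * x - 4 * d)"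
    using e unfolding y by algebra
  then have "5 dvd (2 * w + 1)\<^sup>2 - 2 * x\<^sup>2" by (rule dvdI)
  then show ?thesis by (rule five_dvd_square_diff)
qed

lemma smult_sum_right: "smult c (sum f X) = (\<Sum>x\<in>X. smult c (f x))"
  for f :: "'b \<Rightarrow> 'a :: comm_semiring_0 poly"
  by (induction X rule: infinite_finite_induct) (simp_all add: smult_add_right)

text \<open>Each theta factor is shifted by z^M, so the class of 2M means that the two unshifted
  exponents of z add up to a multiple of 5; every contributing weight 2w+1 is then divisible by
  5.\<close>

lemma coeff_jacobi_cube_theta:
  assumes "[j = 2 * M] (mod 5)" "[i = 3] (mod 5)"
  shows "5 dvd coeff (coeff (smult (jacobi_cube M) (theta M ^ 2)) j) i"
proof -
  let ?w = "\<lambda>k. (2 * int k - 2 * int M - 1) * (-1) ^ (k + 1)"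
  have "smult (jacobi_cube M) (theta M ^ 2) =
    (\<Sum>a\<le>2 * M. \<Sum>b\<le>2 * M. \<Sum>k\<le>2 * M + 1. monom (monom (?w k)
      (tri (int a - int M) + tri (int b - int M) + tri (int k - int M - 1))) (a + b))"
    unfolding jacobi_cube_def theta_def power2_eq_square sum_product smult_sum smult_sum_right
    by (simp only: qz_mult) (simp add: qz_def smult_monom mult_monom add_ac del: sum.atMost_Suc)
  also have "5 dvd coeff (coeff \<dots> j) i"
    unfolding coeff_sum
  proof (intro dvd_sum)
    fix k a b
    let ?t = "tri (int a - int M) + tri (int b - int M) + tri (int k - int M - 1)"
    show "5 dvd coeff (coeff (monom (monom (?w k) ?t) (a + b)) j) i"
    proof (cases "a + b = j \<and> ?t = i")
      case True
      have "[int (a + b) = int (2 * M)] (mod int 5)"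
        using True assms(1) by (simp only: cong_int_iff)
      then have "5 dvd (int a - int M) + (int b - int M)"
        by (simp add: cong_iff_dvd_diff algebra_simps)
      then have "5 dvd 2 * (int k - int M - 1) + 1"
        using True assms(2) by (intro five_dvd_odd_of_tri_sum) auto
      then have "5 dvd 2 * int k - 2 * int M - 1" by (simp add: algebra_simps)
      then have "5 dvd ?w k" by (rule dvd_mult2)
      then show ?thesis by (simp add: coeff_monom)
    qed (auto simp: coeff_monom)
  qed
  finally show ?thesis .
qed

section \<open>Fifth powers as polynomials in z^5 and q^5 modulo 5\<close>

definition supp5 :: "int poly poly \<Rightarrow> bool" where
  "supp5 p \<longleftrightarrow> (\<forall>j i. coeff (coeff p j) i \<noteq> 0 \<longrightarrow> 5 dvd j \<and> 5 dvd i)"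

lemma supp5_add: "supp5 p \<Longrightarrow> supp5 r \<Longrightarrow> supp5 (p + r)"
  unfolding supp5_def by (metis add.right_neutral coeff_add)

lemma supp5_mult:
  assumes "supp5 p" "supp5 r"
  shows "supp5 (p * r)"
  unfolding supp5_def
proof (intro allI impI)
  fix j i assume "coeff (coeff (p * r) j) i \<noteq> 0"
  then have "(\<Sum>l\<le>j. \<Sum>h\<le>i. coeff (coeff p l) h * coeff (coeff r (j - l)) (i - h)) \<noteq> 0"
    by (simp add: coeff_mult coeff_sum)
  then obtain l h where l: "l \<le> j" and h: "h \<le> i"
    and "coeff (coeff p l) h * coeff (coeff r (j - l)) (i - h) \<noteq> 0"
    by (metis (no_types, lifting) atMost_iff sum.neutral)
  then have "5 dvd l \<and> 5 dvd h" "5 dvd j - l \<and> 5 dvd i - h"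
    using assms unfolding supp5_def by auto
  then show "5 dvd j \<and> 5 dvd i"
    using l h by (metis dvd_diffD)
qed

lemma supp5_qz: "5 dvd a \<Longrightarrow> 5 dvd e \<Longrightarrow> supp5 (qz a e)"
  by (simp add: supp5_def coeff_coeff_qz)

lemma supp5_1: "supp5 1"
  using supp5_qz[of 0 0] by simp

lemma supp5_prod: "(\<And>x. x \<in> X \<Longrightarrow> supp5 (f x)) \<Longrightarrow> supp5 (prod f X)"
  by (induction X rule: infinite_finite_induct) (auto intro: supp5_mult supp5_1)

lemma jtp_power5:
  obtains H where "zcong L (jtp M M ^ 5) H" "supp5 H"
proof
  \<comment> \<open>Fifth powers are taken termwise in each binomial factor; \<open>1 ^ 5\<close>
    stays unevaluated to match \<open>zcong_add_power5\<close>.\<close>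
  let ?H = "(\<Prod>i<M. 1 ^ 5 + qz 1 (i + 1) ^ 5) * (\<Prod>i<M. qz 1 0 ^ 5 + qz 0 i ^ 5)"
  show "zcong L (jtp M M ^ 5) ?H"
    unfolding jtp_def power_mult_distrib prod_power_distrib
    by (intro zcong_mult zcong_prod zcong_add_power5)
  show "supp5 ?H"
    unfolding qz_power power_one
    by (intro supp5_mult supp5_prod supp5_add supp5_1 supp5_qz) auto
qed

lemma qpoch_power5:
  obtains E where "tcong L (qpoch M ^ 5) E" "coeff E 0 = 1" "\<And>i. \<not> 5 dvd i \<Longrightarrow> coeff E i = 0"
proof
  let ?E = "\<Prod>i<M. 1 ^ 5 + (- monom 1 (i + 1)) ^ 5 :: int poly"
  have eq: "(- monom 1 (i + 1)) ^ 5 = - (monom 1 (5 * (i + 1)) :: int poly)" for i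
    by (simp add: monom_power mult.commute)
  show "tcong L (qpoch M ^ 5) ?E"
    unfolding qpoch_def prod_power_distrib diff_conv_add_uminus
    by (intro tcong_prod tcong_add_power5)
  show "coeff ?E 0 = 1"
    by (simp only: eq, induction M) (simp_all add: coeff_mult coeff_monom)
  show "coeff ?E i = 0" if "\<not> 5 dvd i" for i
    unfolding eq using that
  proof (induction M arbitrary: i)
    case (Suc M)
    let ?F = "\<Prod>i<M. 1 ^ 5 + - monom 1 (5 * (i + 1)) :: int poly"
    have "coeff ?F i = 0" using Suc by blast
    moreover have "coeff ?F (i - 5 * (M + 1)) = 0" if "5 * (M + 1) \<le> i"
      using that Suc.prems by (intro Suc.IH) presburger
    moreover have "(\<Prod>i<Suc M. 1 ^ 5 + - monom 1 (5 * (i + 1))) = ?F - monom 1 (5 * (M + 1)) * ?F"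
      by (simp add: algebra_simps)
    ultimately show ?case
      by (simp only: coeff_diff coeff_monom_mult) auto
  qed (auto intro!: Nat.gr0I)
qed

theorem theorem3p3:
  fixes n :: nat
  shows "[cphi 7 (5 * n + 3) = 0] (mod 5)"
proof -
  define L where "L = 5 * n + 3"
  define M where "M = 2 * L + 1"
  define Z where "Z = coeff (jtp M M ^ 7) (M * 7)"
  \<comment> \<open>The constant from Jacobi's identity, a unit modulo 5.\<close>
  define A where "A = (2 * (-1) ^ M :: int)"
  obtain H where H: "zcong L (jtp M M ^ 5) H" "supp5 H" by (rule jtp_power5[of L M])
  obtain E where E: "tcong L (qpoch M ^ 5) E" "coeff E 0 = 1" "\<And>i. \<not> 5 dvd i \<Longrightarrow> coeff E i = 0"
    by (rule qpoch_power5[of L M]) blast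
  let ?R = "smult (jacobi_cube M) (theta M ^ 2)"
  have A: "(2 * (-1) ^ M :: int poly) = [:A:]"
    by (cases "even M") (simp_all add: A_def numeral_poly)
  have "tcong L (smult A E * Z) ([:A:] * qpoch M ^ 5 * Z)"
    using tcong_mult[OF tcong_mult[OF tcong_refl tcong_sym[OF E(1)]] tcong_refl, of "[:A:]" Z]
    by simp
  \<comment> \<open>Of the five Euler factors, two go with F^2 to form theta squared and three
    become Jacobi's cube; the remaining F^5 is replaced by \<open>H\<close>.\<close>
  also have "[:A:] * qpoch M ^ 5 * Z =
    coeff (smult ([:A:] * qpoch M ^ 3) (smult (qpoch M) (jtp M M) ^ 2 * jtp M M ^ 5)) (M * 7)"
    by (simp add: Z_def smult_power power_add[symmetric] flip: power_add mult.assoc)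
  also have "tcong L \<dots> (coeff (smult (jacobi_cube M) (theta M ^ 2 * H)) (M * 7))"
  proof -
    have "zcong L (smult ([:A:] * qpoch M ^ 3) (smult (qpoch M) (jtp M M) ^ 2 * jtp M M ^ 5))
      (smult (jacobi_cube M) (theta M ^ 2 * H))"
      unfolding A[symmetric]
      by (intro zcong_smult zcong_mult zcong_power H qpoch_cube qpoch_smult_jtp) (auto simp: M_def)
    then show ?thesis by (simp only: zcong_def)
  qed
  also have "smult (jacobi_cube M) (theta M ^ 2 * H) = H * ?R" by (simp add: mult.commute)
  finally have AZ: "tcong L (smult A E * Z) (coeff (H * ?R) (M * 7))" .
  \<comment> \<open>Extracting z^(7M), a term of \<open>H\<close> uses up a multiple of 5, so the
    other factor is read in the class of 2M.\<close>
  have m: "[M * 7 = 2 * M] (mod 5)" unfolding cong_def by presburger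
  have "5 dvd coeff (coeff (H * ?R) (M * 7)) i" if "[i = 3] (mod 5)" for i
    unfolding coeff_mult coeff_sum
  proof (intro dvd_sum)
    fix l h assume l: "l \<in> {..M * 7}" and h: "h \<in> {..i}"
    show "5 dvd coeff (coeff H l) h * coeff (coeff ?R (M * 7 - l)) (i - h)"
    proof (cases "coeff (coeff H l) h = 0")
      case False
      then have "5 dvd l" "5 dvd h" using H(2) unfolding supp5_def by auto
      then have "[M * 7 - l = 2 * M] (mod 5)" "[i - h = 3] (mod 5)"
        using l h that cong_trans[OF cong_diff_multiple_nat[of 5 l "M * 7"]]
          cong_trans[OF cong_diff_multiple_nat[of 5 h i]] m by auto
      then show ?thesis by (intro dvd_mult coeff_jacobi_cube_theta)
    qed simp
  qed
  then have "5 dvd coeff (smult A E * Z) i" if "i \<le> L" "[i = 3] (mod 5)" for i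
    using AZ that unfolding tcong_def by (meson cong_dvd_iff)
  moreover have "coprime (coeff (smult A E) 0) 5"
    by (cases "even M") (simp_all add: A_def E)
  \<comment> \<open>\<open>smult A E\<close> has unit constant term and lives on multiples of 5, so
    it cancels within the class 3 modulo 5.\<close>
  ultimately have "5 dvd coeff Z L"
    by (intro coeff_mult_cancel_cong[of "smult A E" 5 L 3 Z L]) (auto simp: E L_def cong_def)
  also have "coeff Z L = int (cphi 7 L)"
    unfolding Z_def by (rule cphi_eq_coeff[symmetric]) (simp add: M_def)
  finally have "5 dvd cphi 7 L" by presburger
  then show ?thesis by (simp add: L_def cong_0_iff)
qed

end
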